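(* Let $T$ be a tetrahedron in $\mathbb{R}^3$, and denote by $f_1, f_2, f_3, f_4$ the four triangular facets of $T$. If $$\mathrm{Area}(f_1) = \mathrm{Area}(f_2) \quad\text{and}\quad \mathrm{Area}(f_3) = \mathrm{Area}(f_4),$$ then $f_1 \cong f_2$ and $f_3 \cong f_4$.
   Context: A tetrahedron in $\mathbb{R}^3$ is the convex hull of four affinely independent points (its vertices). Its facets are the four triangles spanned by three of the four vertices. The notation $f \cong g$ means that the triangles $f$ and $g$ are congruent, i.e. there is an isometry carrying one onto the other (equivalently, they have the same three edge lengths, counted with multiplicity). *)

theory Defs
  imports "HOL-Analysis.Analysis"
begin

text \<open>
  Area of a subset of a plane in space: two-dimensional Lebesgue measure after identifying
  the plane with the Euclidean plane by an isometry \<open>g\<close>. Since Lebesgue measure is invariant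
  under isometries, the value does not depend on \<open>g\<close>. Sets not contained in a plane have no
  area: for them the description is unspecified.
\<close>

definition planar_area :: "(real ^ 3) set \<Rightarrow> real" where
  "planar_area S =
     (THE a. \<exists>g :: real ^ 2 \<Rightarrow> real ^ 3.
        (\<forall>x y. dist (g x) (g y) = dist x y) \<and> S \<subseteq> range g \<and>
        a = measure lebesgue (g -` S))"

definition congruent_sets :: "(real ^ 3) set \<Rightarrow> (real ^ 3) set \<Rightarrow> bool"
  where
  "congruent_sets S S' \<longleftrightarrow>
     (\<exists>h :: real ^ 3 \<Rightarrow> real ^ 3. (\<forall>x y. dist (h x) (h y) = dist x y) \<and> h ` S = S')"

end

theory Submission
  imports Defs
begin

text \<open>
  Let \<open>a, b, c, d\<close> be the vertices and put \<open>p = b - a\<close>, \<open>q = d - c\<close>, and \<open>m = a + b - c - d\<close>,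
  twice the vector between the midpoints of the opposite edges \<open>ab\<close> and \<open>cd\<close>. In terms of Gram
  determinants the two equalities of areas read \<open>(q \<bullet> q)(m \<bullet> p) = (q \<bullet> m)(q \<bullet> p)\<close> and
  \<open>(p \<bullet> p)(m \<bullet> q) = (p \<bullet> m)(p \<bullet> q)\<close>: a linear system in \<open>m \<bullet> p\<close> and \<open>m \<bullet> q\<close> whose determinant is
  nonzero because \<open>p\<close> and \<open>q\<close> are independent. Hence \<open>m\<close> is perpendicular to both edges, and the
  half-turn about the line through the two midpoints swaps \<open>a\<close> with \<open>b\<close> and \<open>c\<close> with \<open>d\<close>.
\<close>

text \<open>Subtracting \<open>g 0\<close> leaves a map that preserves norms and distances, hence
  inner products by polarization. Its defects of additivity and homogeneity are then orthogonal to
  themselves.\<close>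

lemma isometry_imp_affine:
  fixes g :: "'a::real_inner \<Rightarrow> 'b::real_inner"
  assumes "\<And>x y. dist (g x) (g y) = dist x y"
  obtains f where "linear f" "\<And>x. g x = g 0 + f x" "\<And>x y. f x \<bullet> f y = x \<bullet> y"
proof -
  define f where "f = (\<lambda>x. g x - g 0)"
  have nd: "norm (f x - f y) = norm (x - y)" for x y
    using assms[of x y] by (simp add: f_def dist_norm)
  have n: "norm (f x) = norm x" for x
    using assms[of x 0] by (simp add: f_def dist_norm)
  have inner: "f x \<bullet> f y = x \<bullet> y" for x y
    using nd[of x y] by (simp add: dot_norm_neg n)
  have "linear f"
  proof
    fix x y :: 'a and r :: real
    have "(f (x + y) - f x - f y) \<bullet> (f (x + y) - f x - f y) = 0"
      by (simp add: inner_diff_left inner_diff_right inner inner_add_left inner_add_right)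
    then show "f (x + y) = f x + f y"
      by (simp add: diff_eq_eq add.commute)
    have "(f (r *\<^sub>R x) - r *\<^sub>R f x) \<bullet> (f (r *\<^sub>R x) - r *\<^sub>R f x) = 0"
      by (simp add: inner_diff_left inner_diff_right inner)
    then show "f (r *\<^sub>R x) = r *\<^sub>R f x"
      by simp
  qed
  with inner show thesis
    by (intro that[of f]) (auto simp: f_def)
qed

lemma convex_hull_isometry_image:
  fixes g :: "'a::real_inner \<Rightarrow> 'b::real_inner"
  assumes "\<And>x y. dist (g x) (g y) = dist x y"
  shows "g ` (convex hull S) = convex hull (g ` S)"
proof -
  obtain f where f: "linear f" "\<And>x. g x = g 0 + f x"
    using isometry_imp_affine[OF assms] by metis
  have "g = (+) (g 0) \<circ> f"
    using f(2) by (metis comp_apply ext)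
  then have "\<And>X. g ` X = (+) (g 0) ` (f ` X)"
    by (metis image_comp)
  then show ?thesis
    by (simp add: convex_hull_translation convex_hull_linear_image f(1))
qed

definition gram :: "'a::real_inner \<Rightarrow> 'a \<Rightarrow> real" where
  "gram u v = (u \<bullet> u) * (v \<bullet> v) - (u \<bullet> v)\<^sup>2"

lemma measure_triangle_gram:
  fixes a b c :: "real ^ 2"
  shows "measure lebesgue (convex hull {a, b, c}) = sqrt (gram (b - a) (c - a)) / 2"
proof -
  have "compact (convex hull {a, b, c})"
    by (simp add: finite_imp_compact_convex_hull)
  then have "measure lebesgue (convex hull {a, b, c}) = measure lborel (convex hull {a, b, c})"
    by (simp add: borel_compact measure_completion)
  \<comment> \<open>In the plane the Gram determinant is the square of the 2x2 determinant whose
    absolute value is twice the area.\<close>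
  moreover have "gram (b - a) (c - a) =
      ((c $ 1 - a $ 1) * (b $ 2 - a $ 2) - (b $ 1 - a $ 1) * (c $ 2 - a $ 2))\<^sup>2"
    by (simp add: gram_def inner_vec_def sum_2 power2_eq_square algebra_simps)
  ultimately show ?thesis
    by (simp add: content_triangle)
qed

text \<open>The definite description needs uniqueness and existence. Every admissible
  \<open>g\<close> pulls the triangle back to one with the same Gram determinant; and since the
  triangle is nondegenerate, \<open>W\<close> is a plane, so some admissible \<open>g\<close>
  exists.\<close>

lemma planar_area_triangle:
  fixes a b c :: "real ^ 3"
  assumes "\<not> affine_dependent {a, b, c}" "distinct [a, b, c]"
  shows "planar_area (convex hull {a, b, c}) = sqrt (gram (b - a) (c - a)) / 2"
proof -
  define W where "W = span {b - a, c - a}"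
  have measure_eq: "measure lebesgue (g -` (convex hull {a, b, c})) = sqrt (gram (b - a) (c - a)) / 2"
    if g: "\<And>x y. dist (g x) (g y) = dist x y" and sub: "convex hull {a, b, c} \<subseteq> range g"
    for g :: "real ^ 2 \<Rightarrow> real ^ 3"
  proof -
    have "{a, b, c} \<subseteq> range g"
      using sub hull_subset by fast
    then obtain a' b' c' where abc: "a = g a'" "b = g b'" "c = g c'"
      by (metis insertI1 insertI2 rangeE subsetD)
    have "inj g"
      by (metis g dist_eq_0_iff injI)
    have "convex hull {a, b, c} = g ` (convex hull {a', b', c'})"
      by (simp add: convex_hull_isometry_image g abc)
    then have "g -` (convex hull {a, b, c}) = convex hull {a', b', c'}"
      by (simp add: inj_vimage_image_eq \<open>inj g\<close>)
    moreover obtain f where f: "linear f" "\<And>x. g x = g 0 + f x" "\<And>x y. f x \<bullet> f y = x \<bullet> y"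
      using isometry_imp_affine[OF g] by metis
    have "g x - g y = f (x - y)" for x y
      by (simp add: f(2)[of x] f(2)[of y] linear_diff f(1))
    then have "gram (b - a) (c - a) = gram (b' - a') (c' - a')"
      by (simp add: gram_def abc f(3))
    ultimately show ?thesis
      by (simp add: measure_triangle_gram)
  qed
  have "independent {b - a, c - a}"
    using assms by (simp add: affine_dependent_iff_dependent)
  moreover have "card {b - a, c - a} = 2"
    using assms by simp
  ultimately have "dim W = 2"
    by (simp add: W_def dim_eq_card_independent)
  then have "dim (UNIV :: (real ^ 2) set) = dim W" "subspace W"
    by (simp_all add: W_def)
  then obtain f :: "real ^ 2 \<Rightarrow> real ^ 3"
    where f: "linear f" "range f = W" "\<And>x. norm (f x) = norm x"
    by (metis isometries_subspaces[OF subspace_UNIV] UNIV_I)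
  define g where "g x = a + f x" for x
  have "range g = (+) a ` W"
    by (auto simp: g_def f(2)[symmetric])
  moreover have "convex ((+) a ` W)"
    by (simp only: W_def convex_translation_eq subspace_imp_convex subspace_span)
  moreover have "{a, b, c} \<subseteq> (+) a ` W"
    by (force simp: W_def image_iff intro: span_0 span_base bexI[of _ "_ - a"])
  ultimately have "convex hull {a, b, c} \<subseteq> range g"
    by (simp add: hull_minimal)
  moreover have "dist (g x) (g y) = dist x y" for x y
    by (simp add: g_def dist_norm flip: linear_diff[OF f(1)] f(3))
  ultimately show ?thesis
    unfolding planar_area_def
    by (intro the_equality exI[of _ g]) (auto simp: measure_eq)
qed

text \<open>A vanishing Gram determinant is the equality case of Cauchy-Schwarz: the two edges would
  be parallel, which is an affine dependence among the vertices.\<close>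

lemma gram_independent:
  fixes a b c d :: "'a::real_inner"
  assumes "\<not> affine_dependent {a, b, c, d}" "distinct [a, b, c, d]"
  shows "gram (b - a) (d - c) \<noteq> 0"
proof
  define p q where "p = b - a" and "q = d - c"
  define x y where "x = q \<bullet> q" and "y = p \<bullet> q"
  assume "gram (b - a) (d - c) = 0"
  \<comment> \<open>The left-hand side equals \<open>(q \<bullet> q) * gram p q\<close>.\<close>
  then have "(x *\<^sub>R p - y *\<^sub>R q) \<bullet> (x *\<^sub>R p - y *\<^sub>R q) = 0"
    by (simp add: gram_def p_def[symmetric] q_def[symmetric] x_def y_def inner_diff_left
        inner_diff_right inner_commute[of q p] power2_eq_square algebra_simps)
  then have xy: "x *\<^sub>R p = y *\<^sub>R q"
    by simp
  have "x \<noteq> 0"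
    using assms(2) by (auto simp: x_def q_def)
  \<comment> \<open>The coefficients of the vertices in
    \<open>x *\<^sub>R p - y *\<^sub>R q\<close>.\<close>
  define U where "U v = (if v = a then - x else if v = b then x else if v = c then y else - y)" for v
  have "sum U {a, b, c, d} = 0" "(\<Sum>v\<in>{a, b, c, d}. U v *\<^sub>R v) = 0"
    using assms(2) xy by (auto simp: U_def p_def q_def algebra_simps)
  moreover have "U a \<noteq> 0"
    using \<open>x \<noteq> 0\<close> by (simp add: U_def)
  ultimately show False
    using assms(1) by (subst (asm) affine_dependent_explicit_finite) auto
qed

text \<open>\<open>h\<close> keeps the component of \<open>x - n\<close> along \<open>m\<close> and
  negates the orthogonal one. For \<open>m = 0\<close> division by zero yields 0, and
  \<open>h\<close> is the point reflection in \<open>n\<close>.\<close>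

lemma half_turn_isometry:
  fixes n m :: "'a::real_inner"
  defines "h \<equiv> \<lambda>x. n + (2 * ((x - n) \<bullet> m) / (m \<bullet> m)) *\<^sub>R m - (x - n)"
  shows "dist (h x) (h y) = dist x y"
proof -
  define z k where "z = x - y" and "k = 2 * (z \<bullet> m) / (m \<bullet> m)"
  have "h x - h y = k *\<^sub>R m - z"
    by (simp add: h_def k_def z_def inner_diff_left algebra_simps diff_divide_distrib)
  moreover have "(k *\<^sub>R m - z) \<bullet> (k *\<^sub>R m - z) = z \<bullet> z"
  proof (cases "m = 0")
    case False
    then have "k * (m \<bullet> m) = 2 * (z \<bullet> m)"
      by (simp add: k_def)
    then show ?thesis
      by (simp add: inner_diff_left inner_diff_right inner_commute[of m z])
  qed simp
  ultimately show ?thesis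
    by (simp add: dist_norm norm_eq z_def)
qed

lemma orthogonal_if_gram_eq:
  fixes m p q :: "'a::real_inner"
  assumes "gram q (m + p) = gram q (m - p)" "gram p (m + q) = gram p (m - q)" "gram p q \<noteq> 0"
  shows "m \<bullet> p = 0" "m \<bullet> q = 0"
proof -
  \<comment> \<open>\<open>gram q\<close> is a quadratic form, so the difference of its values at
    \<open>m + p\<close> and \<open>m - p\<close> is four times its bilinear form at
    \<open>m\<close> and \<open>p\<close>.\<close>
  have 1: "(q \<bullet> q) * (m \<bullet> p) = (m \<bullet> q) * (p \<bullet> q)"
    using assms(1) by (simp add: gram_def inner_simps inner_commute power2_eq_square algebra_simps)
  have 2: "(p \<bullet> p) * (m \<bullet> q) = (m \<bullet> p) * (p \<bullet> q)"
    using assms(2) by (simp add: gram_def inner_simps inner_commute power2_eq_square algebra_simps)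
  have "gram p q * (m \<bullet> p) = 0" "gram p q * (m \<bullet> q) = 0"
    using 1 2 unfolding gram_def by algebra+
  with assms(3) show "m \<bullet> p = 0" "m \<bullet> q = 0"
    by auto
qed

lemma half_turn_swaps_vertices:
  fixes a b c d :: "'a::real_inner"
  assumes "\<not> affine_dependent {a, b, c, d}" "distinct [a, b, c, d]"
    and cd: "gram (d - c) (b - c) = gram (d - c) (a - c)"
    and ab: "gram (b - a) (d - a) = gram (b - a) (c - a)"
  obtains h where "\<And>x y :: 'a. dist (h x) (h y) = dist x y"
    "h a = b" "h b = a" "h c = d" "h d = c"
proof -
  define m p q where "m = a + b - c - d" and "p = b - a" and "q = d - c"
  define n where "n = midpoint c d"
  define h where "h = (\<lambda>x. n + (2 * ((x - n) \<bullet> m) / (m \<bullet> m)) *\<^sub>R m - (x - n))"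
  \<comment> \<open>Adding \<open>u\<close> to \<open>v\<close> is a shear, which preserves the
    area; the factor 1/2 enters squared.\<close>
  have scale: "gram u ((1/2) *\<^sub>R (v + u)) = gram u v / 4" for u v :: 'a
    by (simp add: gram_def inner_simps inner_commute power2_eq_square algebra_simps)
  have neg: "gram u (- v) = gram u v" for u v :: 'a
    by (simp add: gram_def)
  have half: "(1/2::real) *\<^sub>R (x + x) = x" for x :: 'a
    by (simp flip: scaleR_2)
  have "b - c = (1/2) *\<^sub>R ((m + p) + q)" "a - c = (1/2) *\<^sub>R ((m - p) + q)"
       "d - a = (1/2) *\<^sub>R (- (m - q) + p)" "c - a = (1/2) *\<^sub>R (- (m + q) + p)"
    using half by (simp_all add: m_def p_def q_def algebra_simps flip: scaleR_2)
  then have "gram q (m + p) = gram q (m - p)" "gram p (m + q) = gram p (m - q)"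
    using cd ab by (simp_all only: scale neg flip: p_def q_def)
  moreover have "gram p q \<noteq> 0"
    using gram_independent assms(1,2) by (simp add: p_def q_def)
  ultimately have orth: "p \<bullet> m = 0" "q \<bullet> m = 0"
    using orthogonal_if_gram_eq by (metis inner_commute)+
  \<comment> \<open>A perpendicular offset from a point of the axis is negated. Below,
    \<open>r = 1\<close> gives the midpoint of \<open>ab\<close> and \<open>r = 0\<close> that of
    \<open>cd\<close>.\<close>
  have h_eq: "h (n + (r / 2) *\<^sub>R m + u) = n + (r / 2) *\<^sub>R m - u" if "u \<bullet> m = 0" for r u
    using that by (cases "m = 0") (simp_all add: h_def inner_simps algebra_simps flip: scaleR_2)
  have "a = n + (1/2) *\<^sub>R m + (-1/2) *\<^sub>R p" "b = n + (1/2) *\<^sub>R m + (1/2) *\<^sub>R p"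
       "c = n + (0/2) *\<^sub>R m + (-1/2) *\<^sub>R q" "d = n + (0/2) *\<^sub>R m + (1/2) *\<^sub>R q"
    by (simp_all add: n_def m_def p_def q_def midpoint_def algebra_simps flip: scaleR_2)
  then have "h a = b" "h b = a" "h c = d" "h d = c"
    using h_eq[of "(-1/2) *\<^sub>R p" 1] h_eq[of "(1/2) *\<^sub>R p" 1]
      h_eq[of "(-1/2) *\<^sub>R q" 0] h_eq[of "(1/2) *\<^sub>R q" 0] orth by simp_all
  moreover have "dist (h x) (h y) = dist x y" for x y
    unfolding h_def by (rule half_turn_isometry)
  ultimately show thesis
    by (intro that)
qed

theorem theorem2p1:
  fixes T f1 f2 f3 f4 :: "(real ^ 3) set"
  assumes "3 simplex T"
    and "{f. f facet_of T} = {f1, f2, f3, f4}"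
    and "distinct [f1, f2, f3, f4]"
    and "planar_area f1 = planar_area f2"
    and "planar_area f3 = planar_area f4"
  shows "congruent_sets f1 f2 \<and> congruent_sets f3 f4"
proof -
  obtain C where C: "finite C" "\<not> affine_dependent C" "card C = 4" "T = convex hull C"
    using assms(1) by (auto simp: simplex)
  have "\<exists>u\<in>C. f = convex hull (C - {u})" if "f \<in> {f1, f2, f3, f4}" for f
  proof -
    have "f facet_of convex hull C"
      using that assms(2) C(4) by blast
    then show ?thesis
      using C(2) by (auto simp: facet_of_convex_hull_affine_independent)
  qed
  then obtain a b c d where abcd: "a \<in> C" "b \<in> C" "c \<in> C" "d \<in> C"
    and f: "f1 = convex hull (C - {a})" "f2 = convex hull (C - {b})"
      "f3 = convex hull (C - {c})" "f4 = convex hull (C - {d})"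
    by (metis insertI1 insertI2)
  \<comment> \<open>Distinct facets omit distinct vertices, so the four omitted vertices exhaust
    \<open>C\<close>.\<close>
  have dist: "distinct [a, b, c, d]"
    using assms(3) f by auto
  have "{a, b, c, d} = C"
    using C(1,3) abcd dist by (intro card_subset_eq) auto
  then have C_eq: "C = {a, b, c, d}" ..
  \<comment> \<open>The edge shared by the two facets of each pair comes first, so that both areas
    are Gram determinants with that edge as first argument.\<close>
  have f': "f1 = convex hull {c, d, b}" "f2 = convex hull {c, d, a}"
      "f3 = convex hull {a, b, d}" "f4 = convex hull {a, b, c}"
    using dist by (auto simp: f C_eq intro!: arg_cong[where f = "(hull) convex"])
  have indep: "\<not> affine_dependent S" if "S \<subseteq> C" for S
    using that C(2) affine_dependent_subset by blast
  have area: "planar_area (convex hull {x, y, z}) = sqrt (gram (y - x) (z - x)) / 2"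
    if "{x, y, z} \<subseteq> C" "distinct [x, y, z]" for x y z
    using that indep by (intro planar_area_triangle) auto
  have "gram (d - c) (b - c) = gram (d - c) (a - c)" "gram (b - a) (d - a) = gram (b - a) (c - a)"
    using assms(4,5) dist by (auto simp: f' area C_eq)
  then obtain h where h: "\<And>x y. dist (h x) (h y) = dist x y"
    "h a = b" "h b = a" "h c = d" "h d = c"
    using half_turn_swaps_vertices C(2) dist C_eq by metis
  have "h ` f1 = f2" "h ` f3 = f4"
    by (simp_all add: f' convex_hull_isometry_image h insert_commute)
  with h(1) show ?thesis
    unfolding congruent_sets_def by blast
qed

end
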